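(* Let $m$ and $n$ be positive integers, let $\mu$ be the (nonnegative) Lebesgue measure on $\mathbf{R}^n$, and let $1\leq p<+\infty$. Suppose that a sequence $\{u_i\}_{i=1}^{+\infty}$ converges weakly in $(L_\mu^p(\mathbf{R}^n))^m$ to $u$ as $i\rightarrow+\infty$. If $f$ is a nonnegative continuous convex function from $\mathbf{R}^m$ to $\mathbf{R}$, then $$\liminf_{i\rightarrow+\infty}\int_{\Omega}f(u_i)\,d\mu\;\geq\;\int_{\Omega}f(u)\,d\mu$$ for all measurable $\Omega\subseteq\mathbf{R}^n$.
   Context: $L_\mu^p(\mathbf{R}^n)$ is the Banach space of real-valued measurable functions $u$ on $\mathbf{R}^n$ with finite norm $\|u\|_p=\left(\int_{\mathbf{R}^n}|u(x)|^p\,d\mu\right)^{1/p}$ for $1\leq p<+\infty$, and $L_\mu^\infty(\mathbf{R}^n)$ is the Banach space of real-valued measurable functions with finite essential supremum norm. $(L_\mu^p(\mathbf{R}^n))^m$ is the space of measurable vector-valued functions with $m$ components, each in $L_\mu^p(\mathbf{R}^n)$. Weak convergence: for $1<p<+\infty$, a sequence $\{w_i\}$ converges weakly to $w$ in $L_\mu^p(\mathbf{R}^n)$ if $\lim_{i\to+\infty}\int_{\mathbf{R}^n}w_iv\,d\mu=\int_{\mathbf{R}^n}wv\,d\mu$ for all $v\in L_\mu^q(\mathbf{R}^n)$, where $q=\frac{p}{p-1}$; for $p=1$, the same equality is required for all $v\in L_\mu^\infty(\mathbf{R}^n)$. A sequence $u_i=(u_{1i},\dots,u_{mi})$ converges weakly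 to $u=(u_1,\dots,u_m)$ in $(L_\mu^p(\mathbf{R}^n))^m$ if, for each $j=1,\dots,m$, $\{u_{ji}\}_{i=1}^{+\infty}$ converges weakly to $u_j$ in $L_\mu^p(\mathbf{R}^n)$. $f(u)$ denotes the composite function $x\mapsto f(u(x))$. Integrals of nonnegative measurable functions take values in $[0,+\infty]$. *)

theory Defs
  imports "HOL-Analysis.Analysis" "HOL-Probability.Essential_Supremum"
begin

text \<open>
  The Lebesgue spaces are sets of functions rather than of classes modulo almost-everywhere
  equality; no notion below depends on the choice of representatives.
\<close>

text \<open>
  For finite \<open>p \<ge> 1\<close>, the \<open>p\<close>-norm is finite iff its \<open>p\<close>-th power is, so the root is omitted.
\<close>
definition Lp :: "real \<Rightarrow> 'a measure \<Rightarrow> ('a \<Rightarrow> real) set" where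
  "Lp p M = {w \<in> borel_measurable M. (\<integral>\<^sup>+ x. ennreal (\<bar>w x\<bar> powr p) \<partial>M) < \<infinity>}"

definition Linfty :: "'a measure \<Rightarrow> ('a \<Rightarrow> real) set" where
  "Linfty M = {w \<in> borel_measurable M. esssup M (\<lambda>x. ereal \<bar>w x\<bar>) < \<infinity>}"

definition Lp_vec :: "real \<Rightarrow> 'a measure \<Rightarrow> ('a \<Rightarrow> real ^ 'm) set" where
  "Lp_vec p M = {u \<in> borel_measurable M. \<forall>j. (\<lambda>x. u x $ j) \<in> Lp p M}"

definition test_functions :: "real \<Rightarrow> 'a measure \<Rightarrow> ('a \<Rightarrow> real) set" where
  "test_functions p M = (if p = 1 then Linfty M else Lp (p / (p - 1)) M)"

text \<open>
  By Hoelder's inequality the products below are integrable, so the Bochner integrals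
  never take their default value.
\<close>
definition weakly_converges_Lp ::
  "real \<Rightarrow> 'a measure \<Rightarrow> (nat \<Rightarrow> 'a \<Rightarrow> real) \<Rightarrow> ('a \<Rightarrow> real) \<Rightarrow> bool" where
  "weakly_converges_Lp p M ws w \<longleftrightarrow>
     (\<forall>i. ws i \<in> Lp p M) \<and> w \<in> Lp p M \<and>
     (\<forall>v \<in> test_functions p M.
        (\<lambda>i. \<integral>x. ws i x * v x \<partial>M) \<longlonglongrightarrow> (\<integral>x. w x * v x \<partial>M))"

definition weakly_converges_Lp_vec ::
  "real \<Rightarrow> 'a measure \<Rightarrow> (nat \<Rightarrow> 'a \<Rightarrow> real ^ 'm) \<Rightarrow> ('a \<Rightarrow> real ^ 'm) \<Rightarrow> bool" where
  "weakly_converges_Lp_vec p M us u \<longleftrightarrow>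
     (\<forall>i. us i \<in> Lp_vec p M) \<and> u \<in> Lp_vec p M \<and>
     (\<forall>j. weakly_converges_Lp p M (\<lambda>i x. us i x $ j) (\<lambda>x. u x $ j))"

end

theory Submission
  imports Defs
begin

text \<open>
  The idea is to replace \<open>f\<close> from below by affine functions whose coefficients depend on the
  point \<open>x\<close>. If \<open>a x + b x \<bullet> y \<le> f y\<close> for all \<open>y\<close>, with \<open>a\<close> and \<open>b\<close> bounded and measurable, and if
  \<open>A \<subseteq> \<Omega>\<close> has finite measure, then the components of \<open>b\<close> cut off to \<open>A\<close> are admissible test
  functions. Weak convergence therefore passes to the limit in the integrals of
  \<open>a x + b x \<bullet> us i x\<close> over \<open>A\<close>, which shows that the integral of \<open>a x + b x \<bullet> u x\<close> over \<open>A\<close> is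
  at most the lower limit in question (\<open>affine_minorant_liminf_bound\<close>).

  It remains to choose such minorants that nearly touch \<open>f\<close> at \<open>u x\<close>. The tangent to \<open>f\<close> at \<open>u x\<close>
  itself would do, but would require a measurable choice of subgradients. So \<open>u\<close> is approximated
  pointwise by simple functions \<open>s n\<close>, and the \<open>n\<close>-th minorant is tangent to \<open>f\<close> at \<open>s n x\<close>:
  its coefficients take finitely many values, hence are measurable and bounded for an arbitrary
  choice of subgradients. The values of these tangents at \<open>u x\<close> converge to \<open>f (u x)\<close>
  (\<open>tangent_values_tendsto\<close>). With \<open>A n\<close> the part of \<open>\<Omega>\<close> that lies in the \<open>n\<close>-th set of an exhaustion
  by sets of finite measure and where the \<open>n\<close>-th value is nonnegative, Fatou's lemma gives the
  claim, for every \<open>\<sigma>\<close>-finite measure (\<open>convex_integral_weakly_lsc\<close>).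
\<close>

section \<open>Tangents of a convex function\<close>

text \<open>
  A hyperplane separates the point \<open>(q, f q)\<close> from the convex set strictly above the graph of \<open>f\<close>.
  It is not vertical because \<open>f\<close> is finite everywhere, so it is the graph of an affine function.
\<close>
lemma convex_has_subgradient:
  fixes f :: "'a::euclidean_space \<Rightarrow> real"
  assumes f: "convex_on UNIV f"
  shows "\<exists>c. \<forall>y. f q + c \<bullet> (y - q) \<le> f y"
proof -
  define T where "T = {z::'a \<times> real. f (fst z) < snd z}"
  have "convex T"
  proof (rule convexI)
    fix x y :: "'a \<times> real" and s t :: real
    assume xy: "x \<in> T" "y \<in> T" and st: "0 \<le> s" "0 \<le> t" "s + t = 1"
    have "f (s *\<^sub>R fst x + t *\<^sub>R fst y) \<le> s * f (fst x) + t * f (fst y)"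
      using f st by (auto simp: convex_on_def)
    also have "\<dots> < s * snd x + t * snd y"
    proof (cases "s = 0")
      case True
      then show ?thesis using xy st by (simp add: T_def)
    next
      case False
      then have "s * f (fst x) < s * snd x" "t * f (fst y) \<le> t * snd y"
        using xy st by (auto simp: T_def intro: mult_left_mono)
      then show ?thesis by linarith
    qed
    finally show "s *\<^sub>R x + t *\<^sub>R y \<in> T" by (simp add: T_def)
  qed
  moreover have "(q, f q + 1) \<in> T" by (simp add: T_def)
  moreover have "{(q, f q)} \<inter> T = {}" by (simp add: T_def)
  ultimately obtain a b where "a \<noteq> 0" and ab: "\<forall>x\<in>{(q, f q)}. a \<bullet> x \<le> b" "\<forall>x\<in>T. b \<le> a \<bullet> x"
    using separating_hyperplane_sets[of "{(q, f q)}" T] by (metis convex_singleton empty_iff insertI1)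
  define \<alpha> \<beta> where "\<alpha> = fst a" and "\<beta> = snd a"
  have sep: "\<alpha> \<bullet> q + \<beta> * f q \<le> \<alpha> \<bullet> y + \<beta> * t" if "f y < t" for y t
  proof -
    have "(y, t) \<in> T" using that by (simp add: T_def)
    then show ?thesis
      using ab by (force simp: \<alpha>_def \<beta>_def inner_prod_def)
  qed
  have "\<beta> \<noteq> 0"
  proof
    assume "\<beta> = 0"
    then have "\<alpha> \<bullet> q \<le> \<alpha> \<bullet> (q - \<alpha>)"
      using sep[of "q - \<alpha>" "f (q - \<alpha>) + 1"] by simp
    then have "\<alpha> \<bullet> \<alpha> \<le> 0" by (simp add: inner_diff_right)
    then have "\<alpha> = 0" by (metis inner_gt_zero_iff not_le)
    with \<open>\<beta> = 0\<close> \<open>a \<noteq> 0\<close> show False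
      by (simp add: \<alpha>_def \<beta>_def prod_eq_iff)
  qed
  moreover have "0 \<le> \<beta>" using sep[of q "f q + 1"] by (simp add: algebra_simps)
  ultimately have "0 < \<beta>" by simp
  have "f q + (- (1 / \<beta>) *\<^sub>R \<alpha>) \<bullet> (y - q) \<le> f y" for y
  proof (rule field_le_epsilon)
    fix e :: real assume "0 < e"
    then have "\<alpha> \<bullet> q + \<beta> * f q \<le> \<alpha> \<bullet> y + \<beta> * (f y + e)" by (intro sep) simp
    then show "f q + (- (1 / \<beta>) *\<^sub>R \<alpha>) \<bullet> (y - q) \<le> f y + e"
      using \<open>0 < \<beta>\<close> by (simp add: field_simps inner_diff_right)
  qed
  then show ?thesis by blast
qed

text \<open>
  A bound on the subgradients \<open>c (s n)\<close> can be avoided: the tangent at \<open>s n\<close> is affine, so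
  its value at \<open>l\<close> is twice its value at \<open>s n\<close> minus its value at the reflected point
  \<open>2 *\<^sub>R s n - l\<close>. Since \<open>f\<close> dominates the tangent there, this bounds the value at \<open>l\<close> from below by
  values of \<open>f\<close> alone, at points converging to \<open>l\<close>.
\<close>
lemma tangent_values_tendsto:
  fixes f :: "'a::real_inner \<Rightarrow> real"
  assumes f: "continuous_on UNIV f"
    and c: "\<And>q y. f q + c q \<bullet> (y - q) \<le> f y"
    and s: "s \<longlonglongrightarrow> l"
  shows "(\<lambda>n. f (s n) + c (s n) \<bullet> (l - s n)) \<longlonglongrightarrow> f l"
proof (rule tendsto_sandwich)
  show "\<forall>\<^sub>F n in sequentially. f (s n) + c (s n) \<bullet> (l - s n) \<le> f l"
    using c by simp
  have "2 * f (s n) - f (2 *\<^sub>R s n - l) \<le> f (s n) + c (s n) \<bullet> (l - s n)" for n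
    using c[of "s n" "2 *\<^sub>R s n - l"]
    by (simp add: inner_diff_right scaleR_2 algebra_simps)
  then show "\<forall>\<^sub>F n in sequentially.
      2 * f (s n) - f (2 *\<^sub>R s n - l) \<le> f (s n) + c (s n) \<bullet> (l - s n)"
    by simp
  have cont: "(\<lambda>n. f (z n)) \<longlonglongrightarrow> f w" if "z \<longlonglongrightarrow> w" for z w
    using f that by (auto intro: continuous_on_tendsto_compose)
  have "(\<lambda>n. 2 *\<^sub>R s n - l) \<longlonglongrightarrow> 2 *\<^sub>R l - l"
    by (intro tendsto_intros s)
  then have "(\<lambda>n. 2 *\<^sub>R s n - l) \<longlonglongrightarrow> l" by (simp add: scaleR_2)
  then have "(\<lambda>n. 2 * f (s n) - f (2 *\<^sub>R s n - l)) \<longlonglongrightarrow> 2 * f l - f l"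
    by (intro tendsto_intros cont s)
  then show "(\<lambda>n. 2 * f (s n) - f (2 *\<^sub>R s n - l)) \<longlonglongrightarrow> f l" by simp
qed simp

section \<open>Bounded test functions supported on a set of finite measure\<close>

lemma bounded_finite_support_is_test_function:
  assumes p: "1 \<le> p" and v: "v \<in> borel_measurable M"
    and A: "A \<in> sets M" "emeasure M A < \<infinity>"
    and C: "\<And>x. x \<in> space M \<Longrightarrow> \<bar>v x\<bar> \<le> C * indicator A x"
  shows "v \<in> test_functions p M"
proof (cases "p = 1")
  case True
  have "\<bar>v x\<bar> \<le> \<bar>C\<bar>" if "x \<in> space M" for x
    using C[OF that] by (cases "x \<in> A") auto
  then have "esssup M (\<lambda>x. ereal \<bar>v x\<bar>) \<le> ereal \<bar>C\<bar>"
    using v by (intro esssup_I) auto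
  also have "\<dots> < \<infinity>" by simp
  finally show ?thesis using v True by (simp add: test_functions_def Linfty_def)
next
  case False
  define q where "q = p / (p - 1)"
  have "0 < q" using p False by (simp add: q_def)
  have "(\<integral>\<^sup>+x. ennreal (\<bar>v x\<bar> powr q) \<partial>M) \<le> (\<integral>\<^sup>+x. ennreal (\<bar>C\<bar> powr q) * indicator A x \<partial>M)"
  proof (rule nn_integral_mono)
    fix x assume "x \<in> space M"
    from C[OF this] show "ennreal (\<bar>v x\<bar> powr q) \<le> ennreal (\<bar>C\<bar> powr q) * indicator A x"
      using \<open>0 < q\<close> by (cases "x \<in> A") (auto intro!: ennreal_leI powr_mono2)
  qed
  also have "\<dots> = ennreal (\<bar>C\<bar> powr q) * emeasure M A"
    using A by (simp add: nn_integral_cmult_indicator)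
  also have "\<dots> < \<infinity>" using A by (simp add: ennreal_mult_less_top)
  finally show ?thesis
    using v False by (simp add: test_functions_def Lp_def q_def)
qed

text \<open>
  By the elementary bound \<open>t \<le> 1 + t powr p\<close> for \<open>t \<ge> 0\<close>, every function in \<open>Lp p M\<close> is integrable
  over sets of finite measure; a bounded factor preserves this.
\<close>
lemma Lp_mult_bounded_finite_support_integrable:
  assumes p: "1 \<le> p" and w: "w \<in> Lp p M" and v: "v \<in> borel_measurable M"
    and A: "A \<in> sets M" "emeasure M A < \<infinity>"
    and C: "\<And>x. x \<in> space M \<Longrightarrow> \<bar>v x\<bar> \<le> C * indicator A x"
  shows "integrable M (\<lambda>x. w x * v x)"
proof (rule Bochner_Integration.integrable_bound)
  have wm: "w \<in> borel_measurable M"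
    and wi: "(\<integral>\<^sup>+x. ennreal (\<bar>w x\<bar> powr p) \<partial>M) < \<infinity>"
    using w by (auto simp: Lp_def)
  have "integrable M (\<lambda>x. \<bar>w x\<bar> powr p)"
    using wm wi by (intro integrableI_nonneg) auto
  moreover have "integrable M (indicator A :: _ \<Rightarrow> real)"
    using A by simp
  ultimately show "integrable M (\<lambda>x. \<bar>C\<bar> * (indicator A x + \<bar>w x\<bar> powr p))"
    by (intro integrable_mult_right Bochner_Integration.integrable_add)
  show "(\<lambda>x. w x * v x) \<in> borel_measurable M" using wm v by simp
  show "AE x in M. norm (w x * v x) \<le> norm (\<bar>C\<bar> * (indicator A x + \<bar>w x\<bar> powr p))"
  proof (rule AE_I2)
    fix x assume "x \<in> space M"
    note Cx = C[OF this]
    have t: "t \<le> 1 + t powr p" if "0 \<le> t" for t :: real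
    proof (cases "t \<le> 1")
      case True
      then show ?thesis using powr_ge_zero[of t p] by linarith
    next
      case False
      then have "t powr 1 \<le> t powr p" using p by (intro powr_mono) auto
      then show ?thesis using False by simp
    qed
    show "norm (w x * v x) \<le> norm (\<bar>C\<bar> * (indicator A x + \<bar>w x\<bar> powr p))"
    proof (cases "x \<in> A")
      case True
      then have "\<bar>v x\<bar> \<le> \<bar>C\<bar>" using Cx by simp
      then have "\<bar>v x\<bar> * \<bar>w x\<bar> \<le> \<bar>C\<bar> * (1 + \<bar>w x\<bar> powr p)"
        using t[of "\<bar>w x\<bar>"] by (intro mult_mono) auto
      then show ?thesis using True by (simp add: abs_mult mult.commute)
    next
      case False
      then show ?thesis using Cx by simp
    qed
  qed
qed

section \<open>Weak lower semicontinuity\<close>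

lemma integral_le_nn_integral:
  fixes g :: "'a \<Rightarrow> real"
  assumes "integrable M g"
  shows "ennreal (\<integral>x. g x \<partial>M) \<le> (\<integral>\<^sup>+x. ennreal (g x) \<partial>M)"
proof -
  have "(\<integral>x. g x \<partial>M) \<le> (\<integral>x. max 0 (g x) \<partial>M)"
    using assms by (intro integral_mono) auto
  then have "ennreal (\<integral>x. g x \<partial>M) \<le> ennreal (\<integral>x. max 0 (g x) \<partial>M)"
    by (rule ennreal_leI)
  also have "\<dots> = (\<integral>\<^sup>+x. ennreal (max 0 (g x)) \<partial>M)"
    using assms by (intro nn_integral_eq_integral[symmetric]) auto
  also have "\<dots> = (\<integral>\<^sup>+x. ennreal (g x) \<partial>M)"
    by (intro nn_integral_cong) (auto simp: max_def ennreal_neg)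
  finally show ?thesis .
qed

text \<open>
  For \<open>w\<close> in the vector-valued space, \<open>\<integral>x. g w x \<partial>M\<close> is a constant plus a finite sum of
  pairings of the components of \<open>w\<close> with fixed test functions. Hence it is continuous under weak
  convergence, and it bounds the integral of \<open>f (w x)\<close> over \<open>A\<close> from below.
\<close>
lemma affine_minorant_liminf_bound:
  fixes us :: "nat \<Rightarrow> 'a \<Rightarrow> real ^ 'm" and a :: "'a \<Rightarrow> real"
  assumes p: "1 \<le> p" and weak: "weakly_converges_Lp_vec p M us u"
    and A: "A \<in> sets M" "emeasure M A < \<infinity>"
    and a: "a \<in> borel_measurable M" "bounded (a ` space M)"
    and b: "b \<in> borel_measurable M" "bounded (b ` space M)"
    and minorant: "\<And>x y. x \<in> space M \<Longrightarrow> a x + b x \<bullet> y \<le> f y"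
  defines "g \<equiv> \<lambda>w x. indicator A x * (a x + b x \<bullet> w x)"
  shows "integrable M (g u)"
    and "ennreal (\<integral>x. g u x \<partial>M) \<le> liminf (\<lambda>i. \<integral>\<^sup>+x\<in>A. ennreal (f (us i x)) \<partial>M)"
proof -
  define v where "v = (\<lambda>j x. indicator A x * b x $ j)"
  obtain B where B: "\<And>x. x \<in> space M \<Longrightarrow> norm (b x) \<le> B"
    using b(2) by (auto simp: bounded_iff)
  obtain D where D: "\<And>x. x \<in> space M \<Longrightarrow> \<bar>a x\<bar> \<le> D"
    using a(2) by (auto simp: bounded_iff)
  have [measurable]: "A \<in> sets M" "a \<in> borel_measurable M" "b \<in> borel_measurable M"
    by fact+
  have [measurable]: "(\<lambda>x. b x $ j) \<in> borel_measurable M" for j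
    using borel_measurable_inner[OF b(1) borel_measurable_const[of "axis j 1"]]
    by (simp add: inner_axis)
  have vm: "v j \<in> borel_measurable M" for j
    unfolding v_def by measurable
  have vB: "\<bar>v j x\<bar> \<le> B * indicator A x" if "x \<in> space M" for j x
    using order_trans[OF component_le_norm_cart[of "b x" j] B[OF that]]
    by (cases "x \<in> A") (auto simp: v_def)
  have a_int: "integrable M (\<lambda>x. indicator A x * a x)"
  proof (rule Bochner_Integration.integrable_bound[of M "\<lambda>x. D * indicator A x"])
    show "integrable M (\<lambda>x. D * indicator A x)" using A by simp
    show "AE x in M. norm (indicator A x * a x) \<le> norm (D * indicator A x)"
      using D by (intro AE_I2) (force simp: indicator_def)
  qed measurable
  have g_eq: "g w x = indicator A x * a x + (\<Sum>j\<in>UNIV. w x $ j * v j x)" for w x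
    by (simp add: g_def v_def inner_vec_def algebra_simps sum_distrib_left)
  have w_int: "integrable M (\<lambda>x. w x $ j * v j x)" if "w \<in> Lp_vec p M" for w j
    using that
    by (intro Lp_mult_bounded_finite_support_integrable[OF p _ vm A vB])
       (auto simp: Lp_vec_def)
  have g_int: "integrable M (g w)" if "w \<in> Lp_vec p M" for w
    unfolding g_eq using a_int w_int[OF that] by auto
  have g_integral: "(\<integral>x. g w x \<partial>M) =
      (\<integral>x. indicator A x * a x \<partial>M) + (\<Sum>j\<in>UNIV. \<integral>x. w x $ j * v j x \<partial>M)"
    if "w \<in> Lp_vec p M" for w
    unfolding g_eq using a_int w_int[OF that] by simp
  have u: "u \<in> Lp_vec p M" and us: "\<And>i. us i \<in> Lp_vec p M"
    using weak by (auto simp: weakly_converges_Lp_vec_def)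
  show "integrable M (g u)" using g_int u .
  have "v j \<in> test_functions p M" for j
    by (rule bounded_finite_support_is_test_function[OF p vm A vB])
  then have "(\<lambda>i. \<integral>x. us i x $ j * v j x \<partial>M) \<longlonglongrightarrow> (\<integral>x. u x $ j * v j x \<partial>M)" for j
    using weak by (simp add: weakly_converges_Lp_vec_def weakly_converges_Lp_def)
  then have "(\<lambda>i. \<integral>x. g (us i) x \<partial>M) \<longlonglongrightarrow> (\<integral>x. g u x \<partial>M)"
    unfolding g_integral[OF u] g_integral[OF us] by (intro tendsto_intros)
  then have "(\<lambda>i. ennreal (\<integral>x. g (us i) x \<partial>M)) \<longlonglongrightarrow> ennreal (\<integral>x. g u x \<partial>M)"
    by (rule tendsto_ennrealI)
  then have "ennreal (\<integral>x. g u x \<partial>M) = liminf (\<lambda>i. ennreal (\<integral>x. g (us i) x \<partial>M))"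
    by (intro lim_imp_Liminf[symmetric]) auto
  also have "\<dots> \<le> liminf (\<lambda>i. \<integral>\<^sup>+x\<in>A. ennreal (f (us i x)) \<partial>M)"
  proof (intro Liminf_mono always_eventually allI)
    fix i
    have "ennreal (\<integral>x. g (us i) x \<partial>M) \<le> (\<integral>\<^sup>+x. ennreal (g (us i) x) \<partial>M)"
      by (intro integral_le_nn_integral g_int us)
    also have "\<dots> \<le> (\<integral>\<^sup>+x\<in>A. ennreal (f (us i x)) \<partial>M)"
      using minorant by (intro nn_integral_mono) (auto simp: g_def indicator_def intro!: ennreal_leI)
    finally show "ennreal (\<integral>x. g (us i) x \<partial>M) \<le> (\<integral>\<^sup>+x\<in>A. ennreal (f (us i x)) \<partial>M)" .
  qed
  finally show "ennreal (\<integral>x. g u x \<partial>M) \<le> liminf (\<lambda>i. \<integral>\<^sup>+x\<in>A. ennreal (f (us i x)) \<partial>M)" .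
qed

text \<open>
  The sets \<open>A n\<close> exclude the points where the tangent value is negative, because Fatou's lemma
  needs nonnegative integrands. Nothing is lost in the limit: since \<open>f\<close> is nonnegative, the positive
  parts of the tangent values still converge to \<open>f (u x)\<close>.
\<close>
theorem (in sigma_finite_measure) convex_integral_weakly_lsc:
  fixes us :: "nat \<Rightarrow> 'a \<Rightarrow> real ^ 'm"
  assumes p: "1 \<le> p" and weak: "weakly_converges_Lp_vec p M us u"
    and f: "\<And>y. 0 \<le> f y" "continuous_on UNIV f" "convex_on UNIV f"
    and \<Omega>: "\<Omega> \<in> sets M"
  shows "(\<integral>\<^sup>+x\<in>\<Omega>. ennreal (f (u x)) \<partial>M) \<le> liminf (\<lambda>i. \<integral>\<^sup>+x\<in>\<Omega>. ennreal (f (us i x)) \<partial>M)"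
    (is "_ \<le> ?L")
proof -
  obtain c where c: "\<And>q y. f q + c q \<bullet> (y - q) \<le> f y"
    using convex_has_subgradient[OF f(3)] by metis
  have um [measurable]: "u \<in> borel_measurable M"
    using weak by (simp add: weakly_converges_Lp_vec_def Lp_vec_def)
  obtain s where s: "\<And>n. simple_function M (s n)"
    and s_lim: "\<And>x. x \<in> space M \<Longrightarrow> (\<lambda>n. s n x) \<longlonglongrightarrow> u x"
    using borel_measurable_implies_sequence_metric[OF um, of 0] by blast
  obtain K :: "nat \<Rightarrow> 'a set" where K: "range K \<subseteq> sets M" "(\<Union>n. K n) = space M"
      "\<And>n. emeasure M (K n) \<noteq> \<infinity>" "incseq K"
    using sigma_finite_incseq by blast
  \<comment> \<open>\<open>y \<mapsto> a n x + b n x \<bullet> y\<close> is the tangent to \<open>f\<close> at \<open>s n x\<close>, and \<open>h n x\<close> its value at \<open>u x\<close>.\<close>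
  define a where "a = (\<lambda>n x. f (s n x) - c (s n x) \<bullet> s n x)"
  define b where "b = (\<lambda>n x. c (s n x))"
  define h where "h = (\<lambda>n x. a n x + b n x \<bullet> u x)"
  have as: "simple_function M (a n)" and bs: "simple_function M (b n)" for n
    using simple_function_compose[OF s[of n], of "\<lambda>q. f q - c q \<bullet> q"]
      simple_function_compose[OF s[of n], of c]
    by (simp_all add: a_def b_def comp_def)
  note [measurable] = borel_measurable_simple_function[OF as] borel_measurable_simple_function[OF bs]
  have [measurable]: "\<Omega> \<in> sets M" "K n \<in> sets M" for n
    using \<Omega> K by auto
  have hm [measurable]: "h n \<in> borel_measurable M" for n
    unfolding h_def by measurable
  define A where "A = (\<lambda>n. {x \<in> space M. x \<in> \<Omega> \<inter> K n \<and> 0 \<le> h n x})"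
  have Am [measurable]: "A n \<in> sets M" for n
    unfolding A_def by measurable
  have A_fin: "emeasure M (A n) < \<infinity>" for n
  proof -
    have "emeasure M (A n) \<le> emeasure M (K n)"
      by (intro emeasure_mono) (auto simp: A_def)
    then show ?thesis using K(3)[of n] by (simp add: top.not_eq_extremum order_le_less_trans)
  qed
  have bound: "(\<integral>\<^sup>+x. ennreal (indicator (A n) x * h n x) \<partial>M) \<le> ?L" for n
  proof -
    have bnd: "bounded (a n ` space M)" "bounded (b n ` space M)"
      using as[of n] bs[of n] by (auto simp: simple_function_def intro: finite_imp_bounded)
    have minorant: "a n x + b n x \<bullet> y \<le> f y" for x y
      using c[of "s n x" y] by (simp add: a_def b_def inner_diff_right)
    note lower = affine_minorant_liminf_bound[OF p weak Am A_fin
        borel_measurable_simple_function[OF as] bnd(1)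
        borel_measurable_simple_function[OF bs] bnd(2) minorant, folded h_def]
    have "(\<integral>\<^sup>+x. ennreal (indicator (A n) x * h n x) \<partial>M)
        = ennreal (\<integral>x. indicator (A n) x * h n x \<partial>M)"
      using lower(1)
      by (intro nn_integral_eq_integral) (auto simp: A_def h_def indicator_def)
    also have "\<dots> \<le> liminf (\<lambda>i. \<integral>\<^sup>+x\<in>A n. ennreal (f (us i x)) \<partial>M)"
      using lower(2) by (simp add: h_def)
    also have "\<dots> \<le> ?L"
      by (intro Liminf_mono always_eventually allI nn_integral_mono)
         (auto simp: A_def indicator_def)
    finally show ?thesis .
  qed
  have pointwise: "ennreal (f (u x)) * indicator \<Omega> x
      = liminf (\<lambda>n. ennreal (indicator (A n) x * h n x))" if x: "x \<in> space M" for x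
  proof (cases "x \<in> \<Omega>")
    case False
    then show ?thesis by (simp add: A_def Liminf_const)
  next
    case True
    obtain N where "x \<in> K N" using K(2) x by blast
    then have xK: "x \<in> K n" if "N \<le> n" for n
      using K(4) that by (auto simp: incseq_def)
    have "(\<lambda>n. h n x) \<longlonglongrightarrow> f (u x)"
      using tangent_values_tendsto[OF f(2) c s_lim[OF x]]
      by (simp add: h_def a_def b_def inner_diff_right algebra_simps)
    then have "(\<lambda>n. ennreal (h n x)) \<longlonglongrightarrow> ennreal (f (u x))"
      by (rule tendsto_ennrealI)
    \<comment> \<open>Where \<open>h n x\<close> is negative, both sides vanish, because \<open>ennreal\<close> truncates at \<open>0\<close>.\<close>
    moreover have "\<forall>\<^sub>F n in sequentially. ennreal (h n x) = ennreal (indicator (A n) x * h n x)"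
      using eventually_ge_at_top[of N]
      by eventually_elim (use True x xK in \<open>auto simp: A_def indicator_def ennreal_neg\<close>)
    ultimately have "(\<lambda>n. ennreal (indicator (A n) x * h n x)) \<longlonglongrightarrow> ennreal (f (u x))"
      by (rule Lim_transform_eventually)
    then show ?thesis using True by (simp add: lim_imp_Liminf)
  qed
  have "(\<integral>\<^sup>+x\<in>\<Omega>. ennreal (f (u x)) \<partial>M)
      = (\<integral>\<^sup>+x. liminf (\<lambda>n. ennreal (indicator (A n) x * h n x)) \<partial>M)"
    using pointwise by (intro nn_integral_cong) simp
  also have "\<dots> \<le> liminf (\<lambda>n. \<integral>\<^sup>+x. ennreal (indicator (A n) x * h n x) \<partial>M)"
    by (intro nn_integral_liminf) measurable
  also have "\<dots> \<le> liminf (\<lambda>n::nat. ?L)"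
    using bound by (intro Liminf_mono always_eventually) auto
  also have "\<dots> = ?L" by (simp add: Liminf_const)
  finally show ?thesis .
qed

lemma sigma_finite_lebesgue: "sigma_finite_measure (lebesgue :: 'a::euclidean_space measure)"
proof
  let ?B = "range (\<lambda>n. ball (0::'a) (real n))"
  have "x \<in> \<Union> ?B" for x :: 'a
    using reals_Archimedean2[of "norm x"] by (auto simp: dist_norm)
  moreover have "emeasure lebesgue (ball (0::'a) r) \<noteq> \<infinity>" for r
    using emeasure_lborel_ball_finite[of 0 r] by (simp add: less_top)
  ultimately show "\<exists>A. countable A \<and> A \<subseteq> sets (lebesgue :: 'a measure)
      \<and> \<Union>A = space lebesgue \<and> (\<forall>a\<in>A. emeasure lebesgue a \<noteq> \<infinity>)"
    by (intro exI[of _ ?B]) auto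
qed

theorem theorem1:
  fixes p :: real
    and us :: "nat \<Rightarrow> real ^ 'n \<Rightarrow> real ^ 'm"
    and u :: "real ^ 'n \<Rightarrow> real ^ 'm"
    and f :: "real ^ 'm \<Rightarrow> real"
  assumes "1 \<le> p"
    and "weakly_converges_Lp_vec p lebesgue us u"
    and "\<And>y. 0 \<le> f y"
    and "continuous_on UNIV f"
    and "convex_on UNIV f"
  shows "\<forall>\<Omega> \<in> sets lebesgue.
    liminf (\<lambda>i. \<integral>\<^sup>+x\<in>\<Omega>. ennreal (f (us i x)) \<partial>lebesgue)
      \<ge> (\<integral>\<^sup>+x\<in>\<Omega>. ennreal (f (u x)) \<partial>lebesgue)"
  using sigma_finite_measure.convex_integral_weakly_lsc[OF sigma_finite_lebesgue assms] by blast

end
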